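(* For every integer $n \ge 1$ there exists a joint-groups Sudoku of size $n^2$ by $n^2$.
   Context: A complete Sudoku of size $n^2$ by $n^2$ is an $n^2$ by $n^2$ grid, divided into $n^2$ non-overlapping $n$ by $n$ boxes in the standard way (each box is the intersection of one of $n$ horizontal bands of $n$ consecutive rows and one of $n$ vertical stacks of $n$ consecutive columns), filled with the digits $1,\dots,n^2$ so that every row, every column, and every box contains each digit exactly once. Positions inside a box are given by coordinates $(r,c)$ with $1\le r,c\le n$ (row from the top, column from the left within the box). Each digit in a complete Sudoku determines a preference profile of $n$ men (stacks) and $n$ women (bands): if the digit is at position $(i,j)$ within the box at the intersection of band $w$ and stack $m$, then woman $w$ ranks man $m$ as $i$ and man $m$ ranks woman $w$ as $j$. A profile is joint if there is a function $f:\{1,\dots,n\}\to\{1,\dots,n\}$ such that whenever a woman ranks a man as $i$, he ranks her as $f(i)$. Equivalently, the profile of a digit is joint if there is a function $f$ such that in every box the digit occupies a position of the form $(i,f(i))$. A joint-groups Sudoku is a complete Sudoku in which the profile of every digit is joint. *)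

theory Defs
  imports "HOL-Library.FuncSet"
begin

(* Rows and columns of the grid, bands, stacks, positions inside a box and digits
   are all numbered from 1; values outside these ranges are irrelevant. *)
type_synonym grid = "nat \<Rightarrow> nat \<Rightarrow> nat"

(* The row (column) of the grid that is the k-th row (column) of band (stack) b. *)
definition line :: "nat \<Rightarrow> nat \<Rightarrow> nat \<Rightarrow> nat" where
  "line n b k = (b - 1) * n + k"

definition box_entry :: "nat \<Rightarrow> grid \<Rightarrow> nat \<Rightarrow> nat \<Rightarrow> nat \<times> nat \<Rightarrow> nat" where
  "box_entry n S w m = (\<lambda>(i, j). S (line n w i) (line n m j))"

definition complete_sudoku :: "nat \<Rightarrow> grid \<Rightarrow> bool" where
  "complete_sudoku n S \<longleftrightarrow>
     (\<forall>r \<in> {1..n^2}. bij_betw (\<lambda>c. S r c) {1..n^2} {1..n^2}) \<and>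
     (\<forall>c \<in> {1..n^2}. bij_betw (\<lambda>r. S r c) {1..n^2} {1..n^2}) \<and>
     (\<forall>w \<in> {1..n}. \<forall>m \<in> {1..n}.
        bij_betw (box_entry n S w m) ({1..n} \<times> {1..n}) {1..n^2})"

definition digit_pos :: "nat \<Rightarrow> grid \<Rightarrow> nat \<Rightarrow> nat \<Rightarrow> nat \<Rightarrow> nat \<times> nat" where
  "digit_pos n S d w m = (THE p. p \<in> {1..n} \<times> {1..n} \<and> box_entry n S w m p = d)"

(* A profile (W, M): woman w ranks man m as W w m, man m ranks woman w as M m w. *)
type_synonym profile = "(nat \<Rightarrow> nat \<Rightarrow> nat) \<times> (nat \<Rightarrow> nat \<Rightarrow> nat)"

definition digit_profile :: "nat \<Rightarrow> grid \<Rightarrow> nat \<Rightarrow> profile" where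
  "digit_profile n S d =
     ((\<lambda>w m. fst (digit_pos n S d w m)), (\<lambda>m w. snd (digit_pos n S d w m)))"

definition joint_profile :: "nat \<Rightarrow> profile \<Rightarrow> bool" where
  "joint_profile n P \<longleftrightarrow>
     (\<exists>f \<in> {1..n} \<rightarrow> {1..n}. \<forall>w \<in> {1..n}. \<forall>m \<in> {1..n}. \<forall>i \<in> {1..n}.
        fst P w m = i \<longrightarrow> snd P m w = f i)"

definition joint_groups_sudoku :: "nat \<Rightarrow> grid \<Rightarrow> bool" where
  "joint_groups_sudoku n S \<longleftrightarrow>
     complete_sudoku n S \<and> (\<forall>d \<in> {1..n^2}. joint_profile n (digit_profile n S d))"

lemma digit_pos_eq_iff:
  assumes "complete_sudoku n S" "w \<in> {1..n}" "m \<in> {1..n}" "d \<in> {1..n^2}"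
  shows "digit_pos n S d w m = p \<longleftrightarrow> p \<in> {1..n} \<times> {1..n} \<and> box_entry n S w m p = d"
proof -
  have b: "bij_betw (box_entry n S w m) ({1..n} \<times> {1..n}) {1..n^2}"
    using assms unfolding complete_sudoku_def by blast
  have ex: "\<exists>!p. p \<in> {1..n} \<times> {1..n} \<and> box_entry n S w m p = d"
  proof -
    obtain p where p: "p \<in> {1..n} \<times> {1..n}" "box_entry n S w m p = d"
      using bij_betw_imp_surj_on[OF b] assms(4) by (metis (no_types) imageE)
    moreover have "q = p" if "q \<in> {1..n} \<times> {1..n} \<and> box_entry n S w m q = d" for q
      using inj_onD[OF bij_betw_imp_inj_on[OF b], of q p] that p by simp
    ultimately show ?thesis by (intro ex1I[of _ p]) (rule conjI)
  qed
  have P: "digit_pos n S d w m \<in> {1..n} \<times> {1..n} \<and> box_entry n S w m (digit_pos n S d w m) = d"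
    unfolding digit_pos_def by (rule theI'[OF ex])
  show ?thesis
  proof
    assume "digit_pos n S d w m = p"
    with P show "p \<in> {1..n} \<times> {1..n} \<and> box_entry n S w m p = d" by simp
  next
    assume "p \<in> {1..n} \<times> {1..n} \<and> box_entry n S w m p = d"
    then show "digit_pos n S d w m = p"
      unfolding digit_pos_def using ex by (intro the1_equality)
  qed
qed

end

theory Submission imports Defs "HOL-Number_Theory.Cong"
begin

text \<open>
  The grid is written down explicitly. Number bands, stacks and positions inside a box from 0 and
  put at position \<open>(i, j)\<close> of the box in band \<open>w\<close> and stack \<open>m\<close> the digit \<open>1 + n s + t\<close>, where
  \[ s = (i + j) \bmod n, \qquad t = (i + w + m) \bmod n. \]
  A digit is thus a pair \<open>(s, t)\<close> of residues, the two base-\<open>n\<close> places of the digit less one. Its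
  place \<open>s\<close> confines it in every box to the same antidiagonal \<open>j = s - i\<close> (mod \<open>n\<close>), and an
  antidiagonal is the graph of a function of the row: this is jointness
  (\<open>joint_profile_cyclic_grid\<close>). Its place \<open>t\<close> says in which row \<open>i = t - w - m\<close> (mod \<open>n\<close>) of the
  box it stands, and that row runs through a cyclic Latin square as \<open>w\<close> and \<open>m\<close> vary, which
  keeps rows and columns free of repetitions.

  In detail, a row fixes \<open>w\<close> and \<open>i\<close>, so that \<open>s\<close> gives back \<open>j\<close> and \<open>t\<close> gives back \<open>m\<close>; a column
  fixes \<open>m\<close> and \<open>j\<close>, so that \<open>s\<close> gives back \<open>i\<close> and then \<open>t\<close> gives back \<open>w\<close>; a box fixes \<open>w\<close> and
  \<open>m\<close>, so that \<open>t\<close> gives back \<open>i\<close> and then \<open>s\<close> gives back \<open>j\<close>. Each time the entries are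
  distinct, and there are as many of them as digits (\<open>complete_sudoku_cyclic_grid\<close>).
\<close>

definition cyclic_grid :: "nat \<Rightarrow> grid" where
  "cyclic_grid n r c =
     Suc (n * (((r - 1) mod n + (c - 1) mod n) mod n)
          + ((r - 1) mod n + ((r - 1) div n + (c - 1) div n)) mod n)"

lemma add_mod_cancel_left:
  fixes a x y n :: nat
  assumes "(a + x) mod n = (a + y) mod n" "x < n" "y < n"
  shows "x = y"
  using assms cong_add_lcancel_nat[of a x y n] by (simp add: cong_def)

lemma add_mod_cancel_right:
  fixes a x y n :: nat
  assumes "(x + a) mod n = (y + a) mod n" "x < n" "y < n"
  shows "x = y"
  using assms add_mod_cancel_left[of a x n y] by (simp add: add.commute)

lemma cyclic_grid_in_range:
  assumes "n \<ge> 1"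
  shows "cyclic_grid n r c \<in> {1..n\<^sup>2}"
proof -
  have "n * x + y < n\<^sup>2" if "x < n" "y < n" for x y
  proof -
    have "n * x + y < n * Suc x" using that by simp
    also have "\<dots> \<le> n * n" using that by (intro mult_le_mono) auto
    finally show ?thesis by (simp add: power2_eq_square)
  qed
  then show ?thesis using assms by (simp add: cyclic_grid_def Suc_le_eq)
qed

text \<open>
  Both places of a digit are smaller than \<open>n\<close>, so they can be read off as quotient and remainder.
\<close>

lemma cyclic_grid_places:
  assumes "n \<ge> 1"
  shows "(cyclic_grid n r c - 1) div n = ((r - 1) mod n + (c - 1) mod n) mod n"
    and "(cyclic_grid n r c - 1) mod n
           = ((r - 1) mod n + ((r - 1) div n + (c - 1) div n)) mod n"
  using assms by (simp_all add: cyclic_grid_def)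

lemma cyclic_grid_eqD:
  assumes "cyclic_grid n r c = cyclic_grid n r' c'" "n \<ge> 1"
  shows "((r - 1) mod n + (c - 1) mod n) mod n = ((r' - 1) mod n + (c' - 1) mod n) mod n"
    and "((r - 1) mod n + ((r - 1) div n + (c - 1) div n)) mod n
           = ((r' - 1) mod n + ((r' - 1) div n + (c' - 1) div n)) mod n"
  by (simp_all only: cyclic_grid_places[OF assms(2), symmetric] assms(1))

lemma pred_div_less:
  fixes x n :: nat
  assumes "x \<in> {1..n\<^sup>2}"
  shows "(x - 1) div n < n"
proof -
  have "1 \<le> x" "x \<le> n * n" using assms by (simp_all add: power2_eq_square)
  then have "x - 1 < n * n" by linarith
  then show ?thesis by (rule less_mult_imp_div_less)
qed

lemma eq_if_pred_div_mod_eq: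
  fixes x y n :: nat
  assumes "(x - 1) div n = (y - 1) div n" "(x - 1) mod n = (y - 1) mod n" "x \<ge> 1" "y \<ge> 1"
  shows "x = y"
proof -
  have "x - 1 = (x - 1) div n * n + (x - 1) mod n" by simp
  also have "\<dots> = (y - 1) div n * n + (y - 1) mod n" by (simp only: assms)
  also have "\<dots> = y - 1" by simp
  finally have "x - 1 = y - 1" .
  then show ?thesis using assms(3,4) by simp
qed

lemma line_pred_div_mod:
  assumes "k \<in> {1..n}"
  shows "(line n b k - 1) div n = b - 1" and "(line n b k - 1) mod n = k - 1"
proof -
  have "line n b k - 1 = (b - 1) * n + (k - 1)" "k - 1 < n"
    using assms by (auto simp: line_def)
  then show "(line n b k - 1) div n = b - 1" "(line n b k - 1) mod n = k - 1" by simp_all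
qed

lemma bij_betw_if_inj_on_card:
  assumes "inj_on f A" "f ` A \<subseteq> B" "finite B" "card A = card B"
  shows "bij_betw f A B"
  using assms by (simp add: bij_betw_def card_image card_subset_eq)

lemma complete_sudoku_cyclic_grid:
  assumes n: "n \<ge> 1"
  shows "complete_sudoku n (cyclic_grid n)"
  unfolding complete_sudoku_def
proof (intro conjI ballI)
  fix r
  show "bij_betw (\<lambda>c. cyclic_grid n r c) {1..n\<^sup>2} {1..n\<^sup>2}"
  proof (rule bij_betw_if_inj_on_card)
    show "inj_on (\<lambda>c. cyclic_grid n r c) {1..n\<^sup>2}"
    proof (rule inj_onI)
      fix c c' assume c: "c \<in> {1..n\<^sup>2}" "c' \<in> {1..n\<^sup>2}"
        and eq: "cyclic_grid n r c = cyclic_grid n r c'"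
      note places = cyclic_grid_eqD[OF eq n]
      have "(c - 1) mod n = (c' - 1) mod n"
        by (rule add_mod_cancel_left[OF places(1)]) (use n in auto)
      moreover have "(c - 1) div n = (c' - 1) div n"
        using places(2)[folded add.assoc] pred_div_less[OF c(1)] pred_div_less[OF c(2)]
        by (rule add_mod_cancel_left)
      ultimately show "c = c'" using c by (intro eq_if_pred_div_mod_eq[of c n c']) auto
    qed
  qed (use cyclic_grid_in_range[OF n] in auto)
next
  fix c
  show "bij_betw (\<lambda>r. cyclic_grid n r c) {1..n\<^sup>2} {1..n\<^sup>2}"
  proof (rule bij_betw_if_inj_on_card)
    show "inj_on (\<lambda>r. cyclic_grid n r c) {1..n\<^sup>2}"
    proof (rule inj_onI)
      fix r r' assume r: "r \<in> {1..n\<^sup>2}" "r' \<in> {1..n\<^sup>2}"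
        and eq: "cyclic_grid n r c = cyclic_grid n r' c"
      note places = cyclic_grid_eqD[OF eq n]
      have i: "(r - 1) mod n = (r' - 1) mod n"
        by (rule add_mod_cancel_right[OF places(1)]) (use n in auto)
      moreover have "(r - 1) div n = (r' - 1) div n"
        using places(2)[unfolded i add.left_commute[of "(r' - 1) mod n"]]
          pred_div_less[OF r(1)] pred_div_less[OF r(2)]
        by (rule add_mod_cancel_right)
      ultimately show "r = r'" using r by (intro eq_if_pred_div_mod_eq[of r n r']) auto
    qed
  qed (use cyclic_grid_in_range[OF n] in auto)
next
  fix w m
  show "bij_betw (box_entry n (cyclic_grid n) w m) ({1..n} \<times> {1..n}) {1..n\<^sup>2}"
  proof (rule bij_betw_if_inj_on_card)
    show "inj_on (box_entry n (cyclic_grid n) w m) ({1..n} \<times> {1..n})"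
    proof (rule inj_onI, clarify)
      fix i j i' j'
      assume ij: "i \<in> {1..n}" "j \<in> {1..n}" "i' \<in> {1..n}" "j' \<in> {1..n}"
        and eq: "box_entry n (cyclic_grid n) w m (i, j) = box_entry n (cyclic_grid n) w m (i', j')"
      have "cyclic_grid n (line n w i) (line n m j) = cyclic_grid n (line n w i') (line n m j')"
        using eq by (simp add: box_entry_def)
      note places = cyclic_grid_eqD[OF this n, unfolded ij[THEN line_pred_div_mod(1)]
          ij[THEN line_pred_div_mod(2)]]
      have i: "i - 1 = i' - 1"
        by (rule add_mod_cancel_right[OF places(2)]) (use ij in auto)
      moreover have "j - 1 = j' - 1"
        by (rule add_mod_cancel_left[OF places(1)[unfolded i]]) (use ij in auto)
      ultimately show "i = i' \<and> j = j'" using ij by auto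
    qed
  qed (use cyclic_grid_in_range[OF n] in \<open>auto simp: box_entry_def power2_eq_square\<close>)
qed

text \<open>
  The first place \<open>s\<close> of a digit is the index of its antidiagonal in every box, so the column
  within the box is \<open>s - i\<close> modulo \<open>n\<close>, whatever the box.
\<close>

lemma joint_profile_cyclic_grid:
  assumes n: "n \<ge> 1" and d: "d \<in> {1..n\<^sup>2}"
  shows "joint_profile n (digit_profile n (cyclic_grid n) d)"
proof -
  define s where "s = (d - 1) div n"
  have s: "s < n" unfolding s_def by (rule pred_div_less[OF d])
  \<comment> \<open>The summand \<open>n\<close> keeps the truncated subtraction exact.\<close>
  define f where "f i = Suc ((s + n - (i - 1)) mod n)" for i
  have f_range: "f \<in> {1..n} \<rightarrow> {1..n}"
    using n by (simp add: f_def Suc_le_eq)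
  have f_antidiagonal: "(i - 1 + (f i - 1)) mod n = s" if "i \<in> {1..n}" for i
  proof -
    have "(i - 1 + (f i - 1)) mod n = (i - 1 + (s + n - (i - 1))) mod n"
      by (simp add: f_def mod_add_right_eq)
    also have "i - 1 + (s + n - (i - 1)) = s + n" using that by auto
    finally show ?thesis using s by simp
  qed
  have "snd (digit_pos n (cyclic_grid n) d w m) = f (fst (digit_pos n (cyclic_grid n) d w m))"
    if wm: "w \<in> {1..n}" "m \<in> {1..n}" for w m
  proof -
    obtain i j where p: "digit_pos n (cyclic_grid n) d w m = (i, j)" by fastforce
    then have ij: "i \<in> {1..n}" "j \<in> {1..n}"
      and "cyclic_grid n (line n w i) (line n m j) = d"
      using digit_pos_eq_iff[OF complete_sudoku_cyclic_grid[OF n] wm d]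
      by (auto simp: box_entry_def)
    then have "(i - 1 + (j - 1)) mod n = s"
      using cyclic_grid_places(1)[OF n, of "line n w i" "line n m j"]
      by (simp only: s_def line_pred_div_mod(2))
    then have "(i - 1 + (j - 1)) mod n = (i - 1 + (f i - 1)) mod n"
      using f_antidiagonal[OF ij(1)] by simp
    moreover have "f i \<in> {1..n}" using f_range ij(1) by blast
    ultimately have "j - 1 = f i - 1"
      using ij(2) by (intro add_mod_cancel_left[of "i - 1" "j - 1" n "f i - 1"]) auto
    then have "j = f i" using ij(2) \<open>f i \<in> {1..n}\<close> by auto
    then show ?thesis using p by simp
  qed
  then show ?thesis
    unfolding joint_profile_def digit_profile_def using f_range by auto
qed

theorem theorem7:
  fixes n :: nat
  assumes "n \<ge> 1"
  shows "\<exists>S. joint_groups_sudoku n S"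
proof
  show "joint_groups_sudoku n (cyclic_grid n)"
    unfolding joint_groups_sudoku_def
    using complete_sudoku_cyclic_grid[OF assms] joint_profile_cyclic_grid[OF assms]
    by (intro conjI ballI)
qed

end
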